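(* Let $\mathcal{A}$ be a unital Banach algebra and let $a\in\mathcal{A}$ be Moore-Penrose invertible with Moore-Penrose inverse $a^{\dagger}$. If $b\in\mathcal{A}$ obeys the condition $(\mathcal{P})$ at $a$, then $b$ is Moore-Penrose invertible, $bb^{\dagger}=aa^{\dagger}$, $b^{\dagger}b=a^{\dagger}a$ and $b^{\dagger}=(1+a^{\dagger}(b-a))^{-1}a^{\dagger}=a^{\dagger}(1+(b-a)a^{\dagger})^{-1}$.
   Context: $\mathcal{A}$ denotes a complex unital Banach algebra with unit $1$. An element $c\in\mathcal{A}$ is hermitian if $\|\exp(itc)\|=1$ for all $t\in\mathbb{R}$. An element $a\in\mathcal{A}$ is Moore-Penrose invertible if there exists $x\in\mathcal{A}$ with $axa=a$, $xax=x$ and both $ax$ and $xa$ hermitian; such $x$ is unique, is called the Moore-Penrose inverse of $a$ and is denoted $a^{\dagger}$. For $a$ Moore-Penrose invertible, an element $b\in\mathcal{A}$ obeys the condition $(\mathcal{P})$ at $a$ if $b-a=aa^{\dagger}(b-a)a^{\dagger}a$ and $\|a^{\dagger}(b-a)\|<1$. *)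

theory Defs
  imports "HOL-Analysis.Analysis"
begin

(* Complex unital Banach algebras. The library has real Banach algebras only; the complex
   structure is added on top, compatible with the real one. The superclass real_normed_algebra_1
   contains norm 1 = 1 and 0 ~= 1. Neither is a restriction below: if some element is hermitian,
   then t = 0 in the definition of hermitian already gives norm 1 = 1. *)

class scaleC = scaleR +
  fixes scaleC :: "complex \<Rightarrow> 'a \<Rightarrow> 'a" (infixr "*\<^sub>C" 75)
  assumes scaleR_scaleC: "r *\<^sub>R x = complex_of_real r *\<^sub>C x"

class complex_banach_algebra_1 = real_normed_algebra_1 + banach + scaleC +
  assumes scaleC_add_right: "z *\<^sub>C (x + y) = z *\<^sub>C x + z *\<^sub>C y"
    and scaleC_add_left: "(z + w) *\<^sub>C x = z *\<^sub>C x + w *\<^sub>C x"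
    and scaleC_scaleC: "z *\<^sub>C w *\<^sub>C x = (z * w) *\<^sub>C x"
    and mult_scaleC_left: "(z *\<^sub>C x) * y = z *\<^sub>C (x * y)"
    and mult_scaleC_right: "x * (z *\<^sub>C y) = z *\<^sub>C (x * y)"
    and norm_scaleC: "norm (z *\<^sub>C x) = cmod z * norm x"

instantiation complex :: complex_banach_algebra_1
begin

definition scaleC_complex :: "complex \<Rightarrow> complex \<Rightarrow> complex"
  where "scaleC_complex z w = z * w"

instance
  by standard (auto simp: scaleC_complex_def scaleR_conv_of_real algebra_simps norm_mult)

end

(* The class inverse of the library is tied to division rings. *)

definition ring_invertible :: "'a::ring_1 \<Rightarrow> bool"
  where "ring_invertible x \<longleftrightarrow> (\<exists>y. x * y = 1 \<and> y * x = 1)"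

definition ring_inverse :: "'a::ring_1 \<Rightarrow> 'a"
  where "ring_inverse x = (THE y. x * y = 1 \<and> y * x = 1)"

lemma ring_inverse_eqI:
  fixes x y :: "'a::ring_1"
  assumes "x * y = 1" "y * x = 1"
  shows "ring_inverse x = y"
  unfolding ring_inverse_def
proof (rule the_equality)
  fix z assume "x * z = 1 \<and> z * x = 1"
  then show "z = y" by (metis assms mult.assoc mult_1_left mult_1_right)
qed (use assms in simp)

definition hermitian :: "'a::complex_banach_algebra_1 \<Rightarrow> bool"
  where "hermitian c \<longleftrightarrow> (\<forall>t::real. norm (exp ((\<i> * complex_of_real t) *\<^sub>C c)) = 1)"

definition is_mp_inverse :: "'a::complex_banach_algebra_1 \<Rightarrow> 'a \<Rightarrow> bool"
  where "is_mp_inverse a x \<longleftrightarrow>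
    a * x * a = a \<and> x * a * x = x \<and> hermitian (a * x) \<and> hermitian (x * a)"

definition mp_invertible :: "'a::complex_banach_algebra_1 \<Rightarrow> bool"
  where "mp_invertible a \<longleftrightarrow> (\<exists>x. is_mp_inverse a x)"

definition mp_inverse :: "'a::complex_banach_algebra_1 \<Rightarrow> 'a" ("_\<^sup>\<dagger>" [1000] 999)
  where "a\<^sup>\<dagger> = (THE x. is_mp_inverse a x)"

definition condition_P :: "'a::complex_banach_algebra_1 \<Rightarrow> 'a \<Rightarrow> bool"
  where "condition_P a b \<longleftrightarrow>
    b - a = a * a\<^sup>\<dagger> * (b - a) * a\<^sup>\<dagger> * a \<and> norm (a\<^sup>\<dagger> * (b - a)) < 1"

(* Uniqueness of the Moore-Penrose inverse, which makes the definite description above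
   meaningful. *)

lemma exp_scaleC_idempotent:
  fixes p :: "'a::complex_banach_algebra_1"
  assumes "p * p = p"
  shows "exp (z *\<^sub>C p) = 1 - p + exp z *\<^sub>C p"
proof -
  have one: "1 *\<^sub>C x = x" for x :: 'a
    by (metis of_real_1 scaleR_one scaleR_scaleC)
  have lin: "bounded_linear (\<lambda>z. z *\<^sub>C p)"
    by (rule bounded_linear_intro[where K = "norm p"])
      (simp_all add: scaleC_add_left norm_scaleC scaleR_scaleC[where 'a = 'a] scaleC_scaleC
        scaleR_conv_of_real)
  have pow: "(z *\<^sub>C p) ^ Suc n = z ^ Suc n *\<^sub>C p" for n
    by (induction n) (simp_all add: mult_scaleC_left mult_scaleC_right scaleC_scaleC assms mult.commute)
  have "(\<lambda>n. (z *\<^sub>C p) ^ n /\<^sub>R fact n) sums exp (z *\<^sub>C p)"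
    by (rule exp_converges)
  moreover have "(\<lambda>n. (z ^ n /\<^sub>R fact n) *\<^sub>C p) sums (exp z *\<^sub>C p)"
    by (rule bounded_linear.sums[OF lin exp_converges])
  ultimately have "(\<lambda>n. (z *\<^sub>C p) ^ n /\<^sub>R fact n - (z ^ n /\<^sub>R fact n) *\<^sub>C p) sums
      (exp (z *\<^sub>C p) - exp z *\<^sub>C p)"
    by (rule sums_diff)
  moreover have "(z *\<^sub>C p) ^ n /\<^sub>R fact n - (z ^ n /\<^sub>R fact n) *\<^sub>C p = (if n = 0 then 1 - p else 0)" for n
  proof (cases n)
    case (Suc m)
    then show ?thesis
      unfolding Suc pow by (simp add: scaleR_scaleC[where 'a = 'a] scaleC_scaleC scaleR_conv_of_real)
  qed (simp add: one)
  ultimately have "(\<lambda>n. if n = 0 then 1 - p else 0) sums (exp (z *\<^sub>C p) - exp z *\<^sub>C p)"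
    by simp
  moreover have "(\<lambda>n. if n = 0 then 1 - p else 0) sums (1 - p)"
    using sums_single[of 0 "\<lambda>_. 1 - p"] by simp
  ultimately have "exp (z *\<^sub>C p) - exp z *\<^sub>C p = 1 - p"
    by (rule sums_unique2)
  then show ?thesis by (simp add: algebra_simps)
qed

lemma hermitian_idempotent_norm:
  fixes p :: "'a::complex_banach_algebra_1"
  assumes "p * p = p" "hermitian p"
  shows "norm (1 - 2 * p) = 1"
proof -
  have "(-1) *\<^sub>C p = - p"
    using scaleR_scaleC[of "-1" p] by simp
  then have "exp ((\<i> * complex_of_real pi) *\<^sub>C p) = 1 - 2 * p"
    using exp_scaleC_idempotent[OF assms(1), of "\<i> * complex_of_real pi"]
    by (simp add: mult_2 algebra_simps)
  then show ?thesis using assms(2) unfolding hermitian_def by metis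
qed

lemma bounded_unipotent_eq_0:
  fixes d :: "'a::real_normed_algebra_1"
  assumes "d * d = 0" "norm (1 + d) \<le> 1"
  shows "d = 0"
proof (rule ccontr)
  assume "d \<noteq> 0"
  have "(1 + d) ^ n = 1 + real n *\<^sub>R d" for n
    by (induction n) (simp_all add: algebra_simps assms(1))
  moreover have "norm ((1 + d) ^ n) \<le> 1" for n
    by (rule order_trans[OF norm_power_ineq power_le_one[OF norm_ge_zero assms(2)]])
  ultimately have le: "norm (1 + real n *\<^sub>R d) \<le> 1" for n
    by simp
  have "real n * norm d \<le> 2" for n
    using norm_triangle_ineq4[of "1 + real n *\<^sub>R d" 1] le[of n] by simp
  moreover obtain n where "2 < real n * norm d"
    using \<open>d \<noteq> 0\<close> reals_Archimedean3 by (metis zero_less_norm_iff)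
  ultimately show False by (meson not_le)
qed

lemma hermitian_idempotents_eq:
  fixes p q :: "'a::complex_banach_algebra_1"
  assumes "p * p = p" "q * q = q" "hermitian p" "hermitian q"
    and "p * q = q \<and> q * p = p \<or> p * q = p \<and> q * p = q"
  shows "p = q"
proof -
  have le: "norm ((1 - 2 * p) * (1 - 2 * q)) \<le> 1"
    using norm_mult_ineq[of "1 - 2 * p" "1 - 2 * q"]
    by (simp add: hermitian_idempotent_norm assms(1-4))
  have expand: "(1 - 2 * p) * (1 - 2 * q) = 1 - (p + p) - (q + q) + (p * q + p * q + p * q + p * q)"
    by (simp add: mult_2 algebra_simps)
  define d where "d = p + p - (q + q)"
  from assms(5) have "d = 0"
  proof
    assume h: "p * q = q \<and> q * p = p"
    have "- d * - d = 0"
      using h assms(1,2) by (simp add: d_def algebra_simps)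
    moreover have "(1 - 2 * p) * (1 - 2 * q) = 1 + - d"
      unfolding expand d_def using h by simp
    ultimately have "- d = 0"
      using le by (metis bounded_unipotent_eq_0)
    then show ?thesis by simp
  next
    assume h: "p * q = p \<and> q * p = q"
    have "d * d = 0"
      using h assms(1,2) by (simp add: d_def algebra_simps)
    moreover have "(1 - 2 * p) * (1 - 2 * q) = 1 + d"
      unfolding expand d_def using h by simp
    ultimately show ?thesis
      using le by (metis bounded_unipotent_eq_0)
  qed
  then have "2 *\<^sub>R p = 2 *\<^sub>R q" unfolding d_def scaleR_2 by simp
  then show ?thesis by simp
qed

lemma is_mp_inverse_unique:
  fixes a x y :: "'a::complex_banach_algebra_1"
  assumes "is_mp_inverse a x" "is_mp_inverse a y"
  shows "x = y"
proof -
  note d = assms[unfolded is_mp_inverse_def]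
  have "a * x = a * y"
    by (rule hermitian_idempotents_eq) (use d in \<open>auto simp flip: mult.assoc\<close>)
  moreover have "x * a = y * a"
  proof (rule hermitian_idempotents_eq)
    have "x * a * (y * a) = x * (a * y * a)" "y * a * (x * a) = y * (a * x * a)"
      by (simp_all add: mult.assoc)
    then show "x * a * (y * a) = y * a \<and> y * a * (x * a) = x * a \<or>
        x * a * (y * a) = x * a \<and> y * a * (x * a) = y * a"
      using d by simp
  qed (use d in \<open>auto simp flip: mult.assoc\<close>)
  ultimately show ?thesis using d by (metis mult.assoc)
qed

lemma mp_inverse_eqI: "is_mp_inverse a x \<Longrightarrow> a\<^sup>\<dagger> = x"
  unfolding mp_inverse_def using is_mp_inverse_unique by blast

end

theory Submission
  imports Defs
begin

text \<open>Write \<open>c = a\<^sup>\<dagger>\<close> and \<open>e = b - a\<close>. Condition \<open>(\<P>)\<close> gives \<open>a c e = e = e c a\<close>, so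
  \<open>b = a (1 + c e)\<close>, where \<open>1 + c e\<close> is invertible by the Neumann series. Hence
  \<open>x = (1 + c e)\<^sup>-\<^sup>1 c\<close> satisfies \<open>b x = a c\<close> and \<open>x b = c a\<close>. These products are hermitian because
  \<open>c\<close> is the Moore-Penrose inverse of \<open>a\<close>, so \<open>x\<close> is that of \<open>b\<close>.\<close>

lemma ring_inverse_works:
  assumes "ring_invertible x"
  shows "x * ring_inverse x = 1" "ring_inverse x * x = 1"
  using assms ring_inverse_eqI[of x] unfolding ring_invertible_def by auto

text \<open>The Neumann series \<open>S\<close> of \<open>- w\<close> is the inverse; its tail
  factors as \<open>- w * S\<close> and as \<open>S * - w\<close>, one for each side.\<close>

lemma ring_invertible_one_plus:
  fixes w :: "'a::{real_normed_algebra_1, banach}"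
  assumes "norm w < 1"
  shows "ring_invertible (1 + w)"
proof -
  define S where "S = (\<Sum>n. (- w) ^ n)"
  have summable: "summable (\<lambda>n. (- w) ^ n)"
    by (rule complete_algebra_summable_geometric) (simp add: assms)
  have "S = 1 + (\<Sum>n. (- w) ^ Suc n)"
    using suminf_split_head[OF summable] by (simp add: S_def)
  moreover have "(\<Sum>n. (- w) ^ Suc n) = - w * S"
    unfolding S_def power_Suc by (rule suminf_mult[OF summable])
  moreover have "(\<Sum>n. (- w) ^ Suc n) = S * - w"
    unfolding S_def power_Suc2 by (rule suminf_mult2[OF summable, symmetric])
  ultimately have "(1 + w) * S = 1" "S * (1 + w) = 1"
    by (simp_all add: algebra_simps)
  then show ?thesis
    unfolding ring_invertible_def by blast
qed

text \<open>Jacobson's lemma, with explicit inverse \<open>1 - y * u * x\<close>. It covers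
  \<open>1 + e * c\<close> below, where the norm bound is on \<open>c * e\<close>.\<close>

lemma ring_invertible_one_plus_swap:
  fixes x y :: "'a::ring_1"
  assumes "ring_invertible (1 + x * y)"
  shows "ring_invertible (1 + y * x)"
proof -
  define u where "u = ring_inverse (1 + x * y)"
  have "(1 + y * x) * (1 - y * u * x) = 1 + y * x - y * ((1 + x * y) * u) * x"
    and "(1 - y * u * x) * (1 + y * x) = 1 + y * x - y * (u * (1 + x * y)) * x"
    by (simp_all add: algebra_simps)
  then show ?thesis
    using ring_inverse_works[OF assms] unfolding ring_invertible_def u_def by auto
qed

lemma mp_inverse_is_mp_inverse:
  assumes "mp_invertible a"
  shows "is_mp_inverse a (a\<^sup>\<dagger>)"
  using assms mp_inverse_eqI unfolding mp_invertible_def by blast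

theorem theorem4p2:
  fixes a b :: "'a::complex_banach_algebra_1"
  assumes "mp_invertible a"
    and "condition_P a b"
  shows "mp_invertible b
    \<and> b * b\<^sup>\<dagger> = a * a\<^sup>\<dagger>
    \<and> b\<^sup>\<dagger> * b = a\<^sup>\<dagger> * a
    \<and> ring_invertible (1 + a\<^sup>\<dagger> * (b - a))
    \<and> ring_invertible (1 + (b - a) * a\<^sup>\<dagger>)
    \<and> b\<^sup>\<dagger> = ring_inverse (1 + a\<^sup>\<dagger> * (b - a)) * a\<^sup>\<dagger>
    \<and> b\<^sup>\<dagger> = a\<^sup>\<dagger> * ring_inverse (1 + (b - a) * a\<^sup>\<dagger>)"
proof -
  define c e u v where "c = a\<^sup>\<dagger>" and "e = b - a"
    and "u = ring_inverse (1 + c * e)" and "v = ring_inverse (1 + e * c)"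
  have aca: "a * c * a = a" and cac: "c * a * c = c"
    and herm: "hermitian (a * c)" "hermitian (c * a)"
    using mp_inverse_is_mp_inverse[OF assms(1)] unfolding is_mp_inverse_def c_def by auto
  have P: "e = a * c * e * c * a" "norm (c * e) < 1"
    using assms(2) unfolding condition_P_def c_def e_def by auto
  have ace: "a * c * e = e" and eca: "e * c * a = e"
    by (metis P(1) aca mult.assoc)+
  have b: "b = a + e"
    by (simp add: e_def)
  have inv: "ring_invertible (1 + c * e)" "ring_invertible (1 + e * c)"
    using P(2) ring_invertible_one_plus ring_invertible_one_plus_swap by blast+
  note u = ring_inverse_works[OF inv(1), folded u_def]
  note v = ring_inverse_works[OF inv(2), folded v_def]
  have "b = a * (1 + c * e)"
    using ace by (simp add: b algebra_simps)
  then have bx: "b * (u * c) = a * c"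
    using u(1) by (metis mult.assoc mult_1_right)
  have "c * b = (1 + c * e) * (c * a)"
    using eca by (simp add: b algebra_simps)
  then have xb: "u * c * b = c * a"
    using u(2) by (metis mult.assoc mult_1_left)
  \<comment> \<open>By \<open>bx\<close> and \<open>xb\<close>, this and the next fact are
    \<open>b * x * b = b\<close> and \<open>x * b * x = x\<close> for
    \<open>x = u * c\<close>.\<close>
  have "a * c * b = b"
    using aca ace by (simp add: b algebra_simps)
  moreover have "c * a * (u * c) = u * c"
    using bx xb cac by (metis mult.assoc)
  ultimately have "is_mp_inverse b (u * c)"
    unfolding is_mp_inverse_def using bx xb herm by simp
  then have "mp_invertible b" and bd: "b\<^sup>\<dagger> = u * c"
    unfolding mp_invertible_def using mp_inverse_eqI by blast+
  moreover have "u * c = c * v"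
  proof -
    \<comment> \<open>Multiplying by \<open>u\<close> on the left and \<open>v\<close> on the right
      turns this into \<open>u * c = c * v\<close>.\<close>
    have "c * (1 + e * c) = (1 + c * e) * c"
      by (simp add: algebra_simps)
    then show ?thesis
      using u(2) v(1) by (metis mult.assoc mult_1_left mult_1_right)
  qed
  ultimately show ?thesis
    using bx xb inv unfolding c_def e_def u_def v_def by simp
qed

end
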